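(* There exists a positive integer $n_0$ such that for all integers $n\geq n_0$ and $k$ with $2\leq k\leq \frac{n}{2}$ we have \[\vec\chi(KG(n,k))\geq\left\lfloor \tfrac{1}{16}\chi(KG(n,k))\right\rfloor.\]
   Context: The Kneser graph $KG(n,k)$ is the graph with vertex set $\binom{[n]}{k}$ (the $k$-subsets of $[n]=\{1,\dots,n\}$), two vertices being adjacent iff they are disjoint sets. $\chi$ denotes the chromatic number. For a digraph $D$, a proper $k$-colouring is a map $f:V(D)\to[k]$ such that each colour class $f^{-1}(i)$ induces an acyclic subdigraph (no directed cycle); the dichromatic number $\vec\chi(D)$ is the least $k$ admitting a proper $k$-colouring. For an undirected graph $G$, $\vec\chi(G)$ is the maximum of $\vec\chi(D)$ over all orientations $D$ of $G$. *)

theory Defs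
  imports Complex_Main "Graph_Theory.Graph_Theory"
begin

text \<open>
  A simple undirected graph is a symmetric loop-free pair digraph (locale \<^locale>\<open>pair_graph\<close>),
  each edge being represented by its two opposite arcs.
\<close>

definition kneser_graph :: "nat \<Rightarrow> nat \<Rightarrow> nat set pair_pre_digraph" where
  "kneser_graph n k =
    \<lparr> pverts = {A. A \<subseteq> {1..n} \<and> card A = k},
      parcs = {(A, B). A \<subseteq> {1..n} \<and> card A = k \<and> B \<subseteq> {1..n} \<and> card B = k \<and> A \<inter> B = {}} \<rparr>"

definition proper_colouring :: "'a pair_pre_digraph \<Rightarrow> nat \<Rightarrow> ('a \<Rightarrow> nat) \<Rightarrow> bool" where
  "proper_colouring G k f \<longleftrightarrow>
     f ` pverts G \<subseteq> {1..k} \<and> (\<forall>(u, v) \<in> parcs G. f u \<noteq> f v)"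

definition chromatic_number :: "'a pair_pre_digraph \<Rightarrow> nat" where
  "chromatic_number G = (LEAST k. \<exists>f. proper_colouring G k f)"

definition acyclic_digraph :: "('a, 'b) pre_digraph \<Rightarrow> bool" where
  "acyclic_digraph D \<longleftrightarrow> \<not> (\<exists>p. pre_digraph.cycle D p)"

definition proper_dicolouring :: "'a pair_pre_digraph \<Rightarrow> nat \<Rightarrow> ('a \<Rightarrow> nat) \<Rightarrow> bool" where
  "proper_dicolouring D k f \<longleftrightarrow>
     f ` pverts D \<subseteq> {1..k} \<and>
     (\<forall>i \<in> {1..k}. acyclic_digraph (with_proj D \<restriction> {v \<in> pverts D. f v = i}))"

definition dichromatic_number :: "'a pair_pre_digraph \<Rightarrow> nat" where
  "dichromatic_number D = (LEAST k. \<exists>f. proper_dicolouring D k f)"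

text \<open>Exactly one of the two opposite arcs representing each edge is kept.\<close>

definition orientation :: "'a pair_pre_digraph \<Rightarrow> 'a pair_pre_digraph \<Rightarrow> bool" where
  "orientation D G \<longleftrightarrow>
     pverts D = pverts G \<and>
     parcs D \<union> (parcs D)\<inverse> = parcs G \<and>
     parcs D \<inter> (parcs D)\<inverse> = {}"

definition graph_dichromatic_number :: "'a pair_pre_digraph \<Rightarrow> nat" where
  "graph_dichromatic_number G = Max {dichromatic_number D | D. orientation D G}"

text \<open>
  The following facts show that the least and greatest elements above exist
  for every finite simple graph, and that Kneser graphs are such graphs.
\<close>

lemma pair_graph_kneser_graph:
  assumes "k \<ge> 1"
  shows "pair_graph (kneser_graph n k)"
proof -
  have fin: "finite (pverts (kneser_graph n k))"
    by (rule finite_subset[of _ "Pow {1..n}"]) (auto simp: kneser_graph_def)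
  have wf: "fst e \<in> pverts (kneser_graph n k)" "snd e \<in> pverts (kneser_graph n k)"
    if "e \<in> parcs (kneser_graph n k)" for e
    using that by (auto simp: kneser_graph_def)
  have "parcs (kneser_graph n k) \<subseteq> pverts (kneser_graph n k) \<times> pverts (kneser_graph n k)"
    using wf by fastforce
  then have fin': "finite (parcs (kneser_graph n k))"
    using fin by (blast intro: finite_subset)
  have loop: "fst e \<noteq> snd e" if "e \<in> parcs (kneser_graph n k)" for e
  proof
    obtain A B where e: "e = (A, B)" by (cases e)
    assume "fst e = snd e"
    then have "card A = k" "A \<inter> A = {}"
      using that unfolding kneser_graph_def e by auto
    then show False using assms by auto
  qed
  have "sym (parcs (kneser_graph n k))"
    by (rule symI) (simp add: kneser_graph_def Int_commute)
  then have "symmetric (with_proj (kneser_graph n k))"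
    by (simp add: symmetric_def)
  then show ?thesis
    using fin fin' wf loop by (intro pair_graph.intro pair_digraph.intro pair_pseudo_graph.intro
        pair_fin_digraph.intro pair_sym_digraph.intro pair_loopfree_digraph.intro
        pair_wf_digraph.intro pair_fin_digraph_axioms.intro pair_sym_digraph_axioms.intro
        pair_loopfree_digraph_axioms.intro)
qed

lemma (in pair_graph) ex_proper_colouring: "\<exists>k f. proper_colouring G k f"
proof -
  obtain h where "bij_betw h (pverts G) {0..<card (pverts G)}"
    using ex_bij_betw_finite_nat[OF pair_finite_verts] by blast
  then have h: "inj_on h (pverts G)" "h ` pverts G = {0..<card (pverts G)}"
    by (auto simp: bij_betw_def)
  have "proper_colouring G (card (pverts G)) (\<lambda>v. Suc (h v))"
    unfolding proper_colouring_def
  proof (intro conjI)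
    show "(\<lambda>v. Suc (h v)) ` pverts G \<subseteq> {1..card (pverts G)}"
    proof (rule image_subsetI)
      fix v assume "v \<in> pverts G"
      then have "h v \<in> {0..<card (pverts G)}" unfolding h(2)[symmetric] by (rule imageI)
      then show "Suc (h v) \<in> {1..card (pverts G)}" by simp
    qed
    show "\<forall>(u, v)\<in>parcs G. Suc (h u) \<noteq> Suc (h v)"
    proof safe
      fix u v assume uv: "(u, v) \<in> parcs G" and "h u = h v"
      then have "u = v" using inj_onD[OF h(1)] in_arcsD1[OF uv] in_arcsD2[OF uv] by blast
      then show False using pair_no_loops[OF uv] by simp
    qed
  qed
  then show ?thesis by blast
qed

lemma (in pair_graph) proper_colouring_imp_proper_dicolouring:
  assumes "orientation D G" and "proper_colouring G k f"
  shows "proper_dicolouring D k f"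
proof -
  have "\<not> pre_digraph.cycle (with_proj D \<restriction> {v \<in> pverts D. f v = i}) p" for i p
  proof
    let ?H = "with_proj D \<restriction> {v \<in> pverts D. f v = i}"
    assume "pre_digraph.cycle ?H p"
    then obtain e where "e \<in> arcs ?H"
      by (cases p) (auto simp: pre_digraph.cycle_def pre_digraph.awalk_def)
    then have "e \<in> parcs G" "f (fst e) = f (snd e)"
      using assms(1) by (auto simp: orientation_def)
    then show False
      using assms(2) by (auto simp: proper_colouring_def)
  qed
  then show ?thesis
    using assms by (auto simp: proper_dicolouring_def proper_colouring_def
        acyclic_digraph_def orientation_def)
qed

lemma (in pair_graph) finite_orientations: "finite {D. orientation D G}"
proof (rule finite_surj)
  show "finite (Pow (parcs G))" using pair_finite_arcs by simp
  show "{D. orientation D G} \<subseteq>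
    (\<lambda>E. \<lparr>pverts = pverts G, parcs = E\<rparr>) ` Pow (parcs G)"
  proof
    fix D :: "'a pair_pre_digraph"
    assume "D \<in> {D. orientation D G}"
    then have "D = \<lparr>pverts = pverts G, parcs = parcs D\<rparr>" "parcs D \<in> Pow (parcs G)"
      by (auto simp: orientation_def)
    then show "D \<in> (\<lambda>E. \<lparr>pverts = pverts G, parcs = E\<rparr>) ` Pow (parcs G)" by blast
  qed
qed

lemma (in pair_graph) ex_orientation: "\<exists>D. orientation D G"
proof -
  obtain h :: "'a \<Rightarrow> nat" where h: "inj_on h (pverts G)"
    using finite_imp_inj_to_nat_seg[OF pair_finite_verts] by blast
  have opp: "(v, u) \<in> parcs G" if "(u, v) \<in> parcs G" for u v
    using that pair_sym_arcs by (auto simp: symmetric_def sym_def)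
  have "h u \<noteq> h v" if "(u, v) \<in> parcs G" for u v
  proof
    assume "h u = h v"
    then have "u = v" using inj_onD[OF h] in_arcsD1[OF that] in_arcsD2[OF that] by simp
    then show False using pair_no_loops[OF that] by simp
  qed
  then have "orientation \<lparr>pverts = pverts G, parcs = {(u, v) \<in> parcs G. h u < h v}\<rparr> G"
    using opp unfolding orientation_def by (auto simp: neq_iff)
  then show ?thesis by blast
qed

end

theory Submission
  imports Defs "HOL-Library.Multiset"
begin

text \<open>
  By counting, a graph on N vertices has an orientation without a directed complete bipartite
  subgraph K(r,r) as soon as N^2 < 2^r. An acyclic orientation of K(2r,2r) contains a directed
  K(r,r): cut a topological order where one side first has r vertices before the cut. So in a
  dicolouring of such an orientation no colour class contains K(2r,2r). Colour a subset of
  {1..n} by c if at least 2r of its k-subsets have colour c. If d colours are used and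
  d * 2r < (M choose k), then every M-subset has some colour, and if moreover 2M - 2 + d < n, the
  octahedral Tucker lemma yields two disjoint sets of the same colour, hence a monochromatic
  K(2r,2r). With M = (n - d) div 2 this excludes d < (n - 2k + 2) div 16 for large n: for k > 2
  the crude r = 2n + 1 suffices, while k = 2 takes r = n div 4.

  Tucker's lemma comes from Fan's parity argument. Maximal chains of signed subsets are
  represented by signed permutations of 1..n, whose prefixes are the members of the chain.
\<close>

section \<open>Parity, and label lists that alternate in sign\<close>

lemma even_card_involution:
  assumes "finite A" "\<And>x. x \<in> A \<Longrightarrow> f x \<in> A" "\<And>x. x \<in> A \<Longrightarrow> f (f x) = x" "\<And>x. x \<in> A \<Longrightarrow> f x \<noteq> x"
  shows "even (card A)"
  using assms
proof (induction A rule: finite_psubset_induct)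
  case (psubset A)
  show ?case
  proof (cases "A = {}")
    case False
    then obtain x where x: "x \<in> A" by blast
    let ?B = "A - {x, f x}"
    have "even (card ?B)"
    proof (rule psubset.IH)
      show "?B \<subset> A" using x by blast
      show "f y \<in> ?B" if "y \<in> ?B" for y
        using that psubset.prems(1,2) x by (metis Diff_iff insert_iff empty_iff)
    qed (use psubset.prems in auto)
    moreover have "card A = card ?B + 2"
    proof -
      have "card {x, f x} = 2" using psubset.prems(3)[OF x] by simp
      moreover have "{x, f x} \<subseteq> A" using x psubset.prems(1) by blast
      ultimately show ?thesis
        using card_Diff_subset[of "{x, f x}" A] card_mono[OF psubset.hyps, of "{x, f x}"] by simp
    qed
    ultimately show ?thesis by simp
  qed simp
qed

text \<open>The flag \<open>b\<close> prescribes whether the first entry is positive. Only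
  \<open>x > 0\<close> is tested, so 0 counts as negative.\<close>

fun alternating :: "bool \<Rightarrow> int list \<Rightarrow> bool" where
  "alternating b [] = True"
| "alternating b (x # xs) = ((x > 0) = b \<and> alternating (\<not> b) xs)"

definition delete_nth :: "nat \<Rightarrow> 'a list \<Rightarrow> 'a list" where
  "delete_nth i xs = take i xs @ drop (Suc i) xs"

text \<open>Fan's count for one simplex: it is odd exactly when the list alternates from just one of
  the two starting signs. Deleting the head leaves \<open>xs\<close>; every other deletion happens
  in the tail and requires \<open>x\<close> to have sign \<open>b\<close>.\<close>

lemma even_card_delete_nth_alternating:
  "even (card {i. i < length xs \<and> alternating b (delete_nth i xs)})
    \<longleftrightarrow> (alternating b xs \<longleftrightarrow> alternating (\<not> b) xs)"
proof (induction xs arbitrary: b)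
  case (Cons x xs)
  let ?C = "\<lambda>b xs. {i. i < length xs \<and> alternating b (delete_nth i xs)}"
  have eq: "?C b (x # xs) = (if alternating b xs then {0} else {})
      \<union> (if (x > 0) = b then Suc ` ?C (\<not> b) xs else {})"
  proof (rule set_eqI)
    fix i
    show "i \<in> ?C b (x # xs) \<longleftrightarrow> i \<in> (if alternating b xs then {0} else {})
      \<union> (if (x > 0) = b then Suc ` ?C (\<not> b) xs else {})"
      by (cases i) (auto simp: delete_nth_def)
  qed
  have "card (?C b (x # xs)) = (if alternating b xs then 1 else 0)
      + (if (x > 0) = b then card (?C (\<not> b) xs) else 0)"
    unfolding eq by (subst card_Un_disjoint) (auto simp: card_image)
  then show ?case using Cons.IH[of "\<not> b"] by auto
qed simp

definition no_opposites :: "int multiset \<Rightarrow> bool" where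
  "no_opposites M \<longleftrightarrow> 0 \<notin># M \<and> (\<forall>x \<in># M. - x \<notin># M)"

text \<open>A description, since a multiset comes without a list to sort. If there are no opposites,
  entries of equal absolute value are equal, so the sorted list is unique.\<close>

definition sorted_by_abs :: "int multiset \<Rightarrow> int list" where
  "sorted_by_abs M = (THE xs. mset xs = M \<and> sorted (map abs xs))"

lemma no_opposites_inj_on_abs: "no_opposites M \<Longrightarrow> inj_on abs (set_mset M)"
  by (auto simp: no_opposites_def inj_on_def abs_eq_iff)

lemma sorted_by_abs_eqI:
  assumes "no_opposites (mset xs)" "sorted (map abs xs)"
  shows "sorted_by_abs (mset xs) = xs"
  unfolding sorted_by_abs_def
proof (rule the_equality)
  fix ys assume "mset ys = mset xs \<and> sorted (map abs ys)"
  moreover have "inj_on abs (set xs)"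
    using no_opposites_inj_on_abs[OF assms(1)] by simp
  ultimately show "ys = xs"
    using assms(2) sort_key_inj_key_eq[of xs ys abs] sort_key_inj_key_eq[of xs xs abs]
    by metis
qed (use assms in simp)

text \<open>Fan's alternating simplices: the labels of the vertices, read in order of absolute
  value, alternate in sign.\<close>

definition alternating_mset :: "bool \<Rightarrow> int multiset \<Rightarrow> bool" where
  "alternating_mset b M \<longleftrightarrow> alternating b (sorted_by_abs M)"

lemma card_nth_eq_size_filter:
  "card {i. i < length xs \<and> P (xs ! i)} = size (filter_mset P (mset xs))"
  by (metis length_filter_conv_card mset_filter size_mset)

text \<open>A count over positions depends only on the multiset, so \<open>xs\<close> may be
  replaced by its sorted version \<open>ys\<close>. Deleting an entry keeps \<open>ys\<close>
  sorted, and the count for lists applies.\<close>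

lemma even_card_alternating_delete:
  assumes "no_opposites (mset xs)"
  shows "even (card {i. i < length xs \<and> alternating_mset b (mset xs - {#xs ! i#})})
    \<longleftrightarrow> (alternating_mset b (mset xs) \<longleftrightarrow> alternating_mset (\<not> b) (mset xs))"
proof -
  define ys where "ys = sort_key abs xs"
  have ys: "mset ys = mset xs" "sorted (map abs ys)" by (simp_all add: ys_def)
  have del: "alternating_mset b (mset ys - {#ys ! i#}) \<longleftrightarrow> alternating b (delete_nth i ys)"
    if i: "i < length ys" for i
  proof -
    have m: "mset ys = mset (delete_nth i ys) + {#ys ! i#}"
      using i by (metis delete_nth_def id_take_nth_drop mset_append mset.simps(2) union_mset_add_mset_right add_mset_add_single)
    then have "set_mset (mset (delete_nth i ys)) \<subseteq> set_mset (mset xs)"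
      using ys(1) by (metis mset_subset_eq_add_left set_mset_mono)
    then have no: "no_opposites (mset (delete_nth i ys))"
      using assms unfolding no_opposites_def by blast
    have "sorted (map abs (take i ys) @ map abs (drop i ys))"
      using ys(2) by (metis append_take_drop_id map_append)
    moreover have "drop i ys = ys ! i # drop (Suc i) ys" using i by (simp add: Cons_nth_drop_Suc)
    ultimately have "sorted (map abs (delete_nth i ys))"
      by (auto simp: delete_nth_def sorted_append)
    then show ?thesis
      using m sorted_by_abs_eqI[OF no] by (simp add: alternating_mset_def)
  qed
  have "card {i. i < length xs \<and> alternating_mset b (mset xs - {#xs ! i#})}
      = card {i. i < length ys \<and> alternating_mset b (mset ys - {#ys ! i#})}"
    using card_nth_eq_size_filter[of xs "\<lambda>x. alternating_mset b (mset xs - {#x#})"]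
      card_nth_eq_size_filter[of ys "\<lambda>x. alternating_mset b (mset ys - {#x#})"] ys(1) by simp
  also have "{i. i < length ys \<and> alternating_mset b (mset ys - {#ys ! i#})}
      = {i. i < length ys \<and> alternating b (delete_nth i ys)}" using del by blast
  finally show ?thesis
    using even_card_delete_nth_alternating[of ys b] sorted_by_abs_eqI[of ys] assms ys
    by (simp add: alternating_mset_def)
qed

lemma alternating_not_both:
  assumes "alternating b xs" "alternating (\<not> b) xs" shows "xs = []"
  using assms by (cases xs) auto

text \<open>Neighbours of equal absolute value would be equal or opposite; alternation excludes the
  former and \<open>no_opposites\<close> the latter.\<close>

lemma alternating_sorted_imp_distinct_abs:
  assumes "alternating b xs" "sorted (map abs xs)" "no_opposites (mset xs)"
  shows "distinct (map abs xs)"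
  using assms
proof (induction xs arbitrary: b)
  case (Cons x xs)
  have no: "no_opposites (mset xs)" using Cons.prems(3) by (auto simp: no_opposites_def)
  have d: "distinct (map abs xs)" using Cons no by (auto)
  have "\<bar>x\<bar> < \<bar>y\<bar>" if y: "y \<in> set xs" for y
  proof -
    obtain z zs where xs: "xs = z # zs" using y by (cases xs) auto
    have "x \<noteq> z" using Cons.prems(1) xs by auto
    moreover have "x \<noteq> - z" using Cons.prems(3) xs by (auto simp: no_opposites_def)
    ultimately have "\<bar>x\<bar> \<noteq> \<bar>z\<bar>" by (auto simp: abs_eq_iff)
    moreover have "\<bar>x\<bar> \<le> \<bar>z\<bar>" "\<bar>z\<bar> \<le> \<bar>y\<bar>" using Cons.prems(2) xs y by auto
    ultimately show ?thesis by simp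
  qed
  then show ?case using d by fastforce
qed simp

lemma alternating_map_uminus:
  assumes "0 \<notin> set xs"
  shows "alternating b (map uminus xs) \<longleftrightarrow> alternating (\<not> b) xs"
  using assms by (induction xs arbitrary: b) auto

lemma alternating_mset_uminus:
  assumes "no_opposites M"
  shows "alternating_mset b (image_mset uminus M) \<longleftrightarrow> alternating_mset (\<not> b) M"
proof -
  obtain zs where "mset zs = M" using ex_mset by blast
  then obtain xs where xs: "mset xs = M" "sorted (map abs xs)"
    using that[of "sort_key abs zs"] by simp
  have "no_opposites (mset (map uminus xs))" "sorted (map abs (map uminus xs))"
    using assms xs by (auto simp: no_opposites_def comp_def)
  then have "sorted_by_abs (mset (map uminus xs)) = map uminus xs"
    by (rule sorted_by_abs_eqI)
  moreover have "sorted_by_abs M = xs" using sorted_by_abs_eqI[of xs] assms xs by simp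
  moreover have "0 \<notin> set xs" using assms xs by (auto simp: no_opposites_def)
  ultimately show ?thesis using alternating_map_uminus[of xs b] xs(1)
    by (simp add: alternating_mset_def)
qed

lemma size_alternating_mset_le:
  assumes "no_opposites M" "alternating_mset b M" "\<And>x. x \<in># M \<Longrightarrow> \<bar>x\<bar> \<le> int m"
  shows "size M \<le> m"
proof -
  obtain zs where "mset zs = M" using ex_mset by blast
  then obtain xs where xs: "mset xs = M" "sorted (map abs xs)"
    using that[of "sort_key abs zs"] by simp
  have "alternating b xs"
    using assms(1,2) xs sorted_by_abs_eqI[of xs] by (simp add: alternating_mset_def)
  then have d: "distinct (map abs xs)"
    using alternating_sorted_imp_distinct_abs assms(1) xs by blast
  have "set (map abs xs) \<subseteq> {1..int m}"
  proof
    fix y assume "y \<in> set (map abs xs)"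
    then obtain x where "x \<in># M" "y = \<bar>x\<bar>" using xs(1) by auto
    then show "y \<in> {1..int m}"
      using assms(1) assms(3)[of x] by (cases "x = 0") (auto simp: no_opposites_def)
  qed
  then have "card (set (map abs xs)) \<le> card {1..int m}" by (intro card_mono) auto
  then show ?thesis using distinct_card[OF d] xs(1) by auto
qed

section \<open>Signed sets and signed permutations\<close>

text \<open>Nonzero sign vectors, that is, faces of the cross-polytope: \<open>i\<close> stands for
  a plus and \<open>- i\<close> for a minus at coordinate \<open>i\<close>. The last condition also
  keeps 0 out.\<close>

definition signed_sets :: "nat \<Rightarrow> int set set" where
  "signed_sets n = {X. X \<noteq> {} \<and> X \<subseteq> {- int n..int n} \<and> (\<forall>x \<in> X. - x \<notin> X)}"

text \<open>Top-dimensional simplices in the barycentric subdivision of the cross-polytope boundary.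
  The vertex with index \<open>j\<close> is the set of the first \<open>j + 1\<close>
  letters.\<close>

definition signed_words :: "nat \<Rightarrow> int list set" where
  "signed_words n = {w. distinct (map abs w) \<and> set (map abs w) = {1..int n}}"

lemma length_signed_words:
  assumes "w \<in> signed_words n" shows "length w = n"
  using assms distinct_card[of "map abs w"] by (simp add: signed_words_def)

lemma finite_signed_words: "finite (signed_words n)"
proof (rule finite_subset)
  show "signed_words n \<subseteq> {w. set w \<subseteq> {- int n..int n} \<and> length w \<le> n}"
  proof
    fix w assume w: "w \<in> signed_words n"
    have "x \<in> {- int n..int n}" if "x \<in> set w" for x
    proof -
      have "\<bar>x\<bar> \<in> {1..int n}" using w that unfolding signed_words_def
        by (metis (mono_tags, lifting) image_eqI image_set mem_Collect_eq)
      then show ?thesis by auto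
    qed
    then show "w \<in> {w. set w \<subseteq> {- int n..int n} \<and> length w \<le> n}"
      using length_signed_words[OF w] by blast
  qed
  show "finite {w. set w \<subseteq> {- int n..int n} \<and> length w \<le> n}"
    by (rule finite_lists_length_le) simp
qed

text \<open>Two bounds appear because the labelling is fixed on the signed sets for
  \<open>N\<close>, while the induction on dimension runs through words of every length
  \<open>n \<le> N\<close>.\<close>

lemma set_prefix_in_signed_sets:
  assumes "w \<in> signed_words n" "n \<le> N" "j < n"
  shows "set (take (Suc j) w) \<in> signed_sets N"
proof -
  have len: "length w = n" using length_signed_words assms(1) by blast
  have "\<bar>x\<bar> \<in> {1..int n}" if "x \<in> set w" for x
    using assms(1) that unfolding signed_words_def
    by (metis (mono_tags, lifting) image_eqI image_set mem_Collect_eq)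
  note abs = this
  have inj: "inj_on abs (set w)" using assms(1) by (simp add: signed_words_def distinct_map)
  have "- x \<notin> set w" if x: "x \<in> set w" for x
  proof
    assume "- x \<in> set w"
    then have "x = - x" using inj_onD[OF inj, of x "- x"] x by simp
    then show False using abs[OF x] by auto
  qed
  moreover have "x \<in> {- int N..int N}" if "x \<in> set w" for x
    using abs[OF that] assms(2) by auto
  moreover have "set (take (Suc j) w) \<subseteq> set w" by (rule set_take_subset)
  moreover have "set (take (Suc j) w) \<noteq> {}" using len assms(3) by auto
  ultimately show ?thesis by (auto simp: signed_sets_def)
qed

lemma map_uminus_signed_words: "w \<in> signed_words n \<Longrightarrow> map uminus w \<in> signed_words n"
  by (simp add: signed_words_def comp_def image_image)

text \<open>Identifies the simplices of the lower sphere with the facets on the equator that bounds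
  a hemisphere.\<close>

lemma signed_words_append_iff:
  "w @ [int (Suc m)] \<in> signed_words (Suc m) \<longleftrightarrow> w \<in> signed_words m"
proof -
  have "{1..int (Suc m)} = insert (int (Suc m)) {1..int m}" by auto
  moreover have "int (Suc m) \<notin> {1..int m}" by simp
  moreover have "set (map abs (w @ [int (Suc m)])) = insert (int (Suc m)) (set (map abs w))"
    by auto
  moreover have "distinct (map abs (w @ [int (Suc m)])) \<longleftrightarrow>
      distinct (map abs w) \<and> int (Suc m) \<notin> set (map abs w)" by auto
  moreover have "(c \<notin> A \<and> insert c A = insert c S) \<longleftrightarrow> A = S" if "c \<notin> S" for c :: int and A S
    using that by (metis insert_ident)
  ultimately show ?thesis unfolding signed_words_def mem_Collect_eq by presburger
qed

text \<open>Exchanging two adjacent letters alters only vertex \<open>i\<close> of the chain, and so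
  leads to the neighbouring simplex across the facet that omits this vertex.\<close>

lemma set_take_swap:
  assumes "Suc i < length w" "j \<noteq> i"
  shows "set (take (Suc j) (w[i := w ! Suc i, Suc i := w ! i])) = set (take (Suc j) w)"
proof (cases "j < i")
  case True
  then show ?thesis by (simp add: take_update_cancel)
next
  case False
  then have j: "Suc i < Suc j" using assms(2) by simp
  have "take (Suc j) (w[i := w ! Suc i, Suc i := w ! i])
      = (take (Suc j) w)[i := take (Suc j) w ! Suc i, Suc i := take (Suc j) w ! i]"
    using j by (simp add: take_update_swap)
  also have "set \<dots> = set (take (Suc j) w)"
    using j assms(1) by (intro set_swap) auto
  finally show ?thesis .
qed

lemma swap_signed_words:
  assumes "w \<in> signed_words n" "Suc i < n"
  shows "w[i := w ! Suc i, Suc i := w ! i] \<in> signed_words n"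
proof -
  have len: "length w = n" using length_signed_words assms(1) by blast
  have "mset (w[i := w ! Suc i, Suc i := w ! i]) = mset w"
    using mset_swap[of i w "Suc i"] len assms(2) by (simp add: list_update_swap[of i "Suc i"])
  then have eq: "mset (map abs (w[i := w ! Suc i, Suc i := w ! i])) = mset (map abs w)" by simp
  show ?thesis using assms(1) mset_eq_imp_distinct_iff[OF eq] mset_eq_setD[OF eq]
    by (simp add: signed_words_def del: set_map)
qed

lemma flip_signed_words:
  assumes "w \<in> signed_words n" "i < n"
  shows "w[i := - w ! i] \<in> signed_words n"
proof -
  have "map abs (w[i := - w ! i]) = map abs w"
    using length_signed_words[OF assms(1)] assms(2) by (simp add: map_update) (metis list_update_id nth_map)
  then show ?thesis using assms(1) by (simp add: signed_words_def del: set_map)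
qed

section \<open>Fan's parity argument and Tucker's lemma\<close>

text \<open>The hypotheses of the octahedral Tucker lemma, without a bound on the labels. The case
  \<open>X = Y\<close> of the second one says that no label is 0.\<close>

locale tucker_labelling =
  fixes N :: nat and l :: "int set \<Rightarrow> int"
  assumes antipodal: "X \<in> signed_sets N \<Longrightarrow> l (uminus ` X) = - l X"
    and no_complementary: "\<lbrakk>X \<in> signed_sets N; Y \<in> signed_sets N; X \<subseteq> Y\<rbrakk> \<Longrightarrow> l X \<noteq> - l Y"
begin

text \<open>\<open>I\<close> selects a face of the simplex \<open>w\<close>; the facet opposite to
  vertex \<open>i\<close> has \<open>I = {..<n} - {i}\<close>.\<close>

definition labels :: "int list \<Rightarrow> nat set \<Rightarrow> int multiset" where
  "labels w I = image_mset (\<lambda>j. l (set (take (Suc j) w))) (mset_set I)"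

text \<open>The prefixes of a word form a chain, so \<open>no_complementary\<close> applies to any
  two of them in one order or the other.\<close>

lemma no_opposites_labels:
  assumes w: "w \<in> signed_words n" and n: "n \<le> N" and I: "I \<subseteq> {..<n}"
  shows "no_opposites (labels w I)"
proof -
  have fin: "finite I" using I finite_subset by blast
  have opp: "l (set (take (Suc i) w)) \<noteq> - l (set (take (Suc j) w))" if "i < n" "j < n" for i j
  proof (cases "i \<le> j")
    case True
    then show ?thesis using that
      by (intro no_complementary set_prefix_in_signed_sets[OF w n] set_take_subset_set_take) auto
  next
    case False
    then have "l (set (take (Suc j) w)) \<noteq> - l (set (take (Suc i) w))" using that
      by (intro no_complementary set_prefix_in_signed_sets[OF w n] set_take_subset_set_take) auto
    then show ?thesis by linarith
  qed
  have "l (set (take (Suc i) w)) \<noteq> 0" if "i \<in> I" for i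
    using opp[of i i] that I by auto
  moreover have "l (set (take (Suc i) w)) \<noteq> - l (set (take (Suc j) w))" if "i \<in> I" "j \<in> I" for i j
    using opp that I by blast
  ultimately show ?thesis using fin unfolding no_opposites_def labels_def
    by (auto simp: image_iff) metis
qed

lemma labels_map_uminus:
  assumes "w \<in> signed_words n" "n \<le> N"
  shows "labels (map uminus w) {..<n} = image_mset uminus (labels w {..<n})"
  unfolding labels_def multiset.map_comp
proof (rule image_mset_cong)
  fix j assume "j \<in># mset_set {..<n}"
  then have "set (take (Suc j) w) \<in> signed_sets N"
    using set_prefix_in_signed_sets[OF assms] by simp
  then show "l (set (take (Suc j) (map uminus w))) = (uminus \<circ> (\<lambda>j. l (set (take (Suc j) w)))) j"
    using antipodal by (simp add: take_map)
qed

lemma labels_cong: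
  "(\<And>j. j \<in> I \<Longrightarrow> set (take (Suc j) w) = set (take (Suc j) w')) \<Longrightarrow> labels w I = labels w' I"
  unfolding labels_def by (cases "finite I") (auto intro!: image_mset_cong)

lemma labels_append:
  assumes "length v = m"
  shows "labels (v @ [x]) ({..<Suc m} - {m}) = labels v {..<m}"
proof -
  have "{..<Suc m} - {m} = {..<m}" by auto
  moreover have "labels (v @ [x]) {..<m} = labels v {..<m}"
    by (rule labels_cong) (use assms in simp)
  ultimately show ?thesis by simp
qed

definition alternating_words :: "nat \<Rightarrow> int list set" where
  "alternating_words n = {w \<in> signed_words n. alternating_mset True (labels w {..<n})}"

lemma even_card_alternating_facets:
  assumes w: "w \<in> signed_words n" and n: "n \<le> N"
  shows "even (card {i. i < n \<and> alternating_mset b (labels w ({..<n} - {i}))})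
    \<longleftrightarrow> (alternating_mset b (labels w {..<n}) \<longleftrightarrow> alternating_mset (\<not> b) (labels w {..<n}))"
proof -
  define xs where "xs = map (\<lambda>j. l (set (take (Suc j) w))) [0..<n]"
  have xs: "mset xs = labels w {..<n}" by (simp add: xs_def labels_def lessThan_atLeast0)
  have "labels w ({..<n} - {i}) = mset xs - {#xs ! i#}" if "i < n" for i
    using that unfolding xs labels_def
    by (subst mset_set_Diff) (auto simp: image_mset_Diff xs_def)
  then have "{i. i < n \<and> alternating_mset b (labels w ({..<n} - {i}))}
      = {i. i < length xs \<and> alternating_mset b (mset xs - {#xs ! i#})}"
    by (auto simp: xs_def)
  then show ?thesis
    using even_card_alternating_delete[of xs b] no_opposites_labels[OF w n] xs by simp
qed

lemma not_alternating_both: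
  assumes w: "w \<in> signed_words n" and n: "n \<le> N" "n > 0"
  shows "\<not> (alternating_mset b (labels w {..<n}) \<and> alternating_mset (\<not> b) (labels w {..<n}))"
proof
  assume "alternating_mset b (labels w {..<n}) \<and> alternating_mset (\<not> b) (labels w {..<n})"
  then have e: "sorted_by_abs (labels w {..<n}) = []"
    using alternating_not_both unfolding alternating_mset_def by blast
  obtain zs where "mset zs = labels w {..<n}" using ex_mset by blast
  then have "sorted_by_abs (labels w {..<n}) = sort_key abs zs"
    using sorted_by_abs_eqI[of "sort_key abs zs"] no_opposites_labels[OF w n(1), of "{..<n}"] by simp
  then have "zs = []" using e by (metis length_0_conv length_sort)
  then have "labels w {..<n} = {#}" using \<open>mset zs = _\<close> by simp
  then have "mset_set {..<n} = {#}" by (simp add: labels_def)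
  then show False using n(2) by (metis finite_lessThan lessThan_iff empty_iff mset_set_empty_iff)
qed

text \<open>Facets of simplices in a closed hemisphere: each interior one lies in two simplices of
  the hemisphere, each boundary one in a single simplex.\<close>

lemma odd_card_alternating_words_Suc:
  assumes m: "Suc m \<le> N" and odd: "odd (card (alternating_words m))"
  shows "odd (card (alternating_words (Suc m)))"
proof -
  let ?n = "Suc m"
  \<comment> \<open>The closed hemisphere: in no vertex of such a simplex is coordinate
    \<open>Suc m\<close> negative.\<close>
  define H where "H = {w \<in> signed_words ?n. int ?n \<in> set w}"
  have finH: "finite H" using finite_signed_words by (simp add: H_def)
  define F where "F = (\<lambda>w. {i. i < ?n \<and> alternating_mset True (labels w ({..<?n} - {i}))})"
  \<comment> \<open>A pair is a simplex of the hemisphere with one of its alternating facets, given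
    by the omitted vertex.\<close>
  define P where "P = Sigma H F"
  \<comment> \<open>The facets on the equator: the last letter is the only one with the new
    coordinate, and the only vertex containing it is omitted.\<close>
  define Q where "Q = {(w, i) \<in> P. i = m \<and> w ! m = int ?n}"
  \<comment> \<open>\<open>g\<close> passes to the other simplex with the same facet. Flipping the
    last letter leaves the hemisphere only if that letter is \<open>int ?n\<close>, which is the
    case of \<open>Q\<close>.\<close>
  define g :: "int list \<times> nat \<Rightarrow> int list \<times> nat" where "g = (\<lambda>(w, i). if i < m then (w[i := w ! Suc i, Suc i := w ! i], i)
    else (w[m := - w ! m], m))"
  have finP: "finite P" using finH by (auto simp: P_def F_def)
  have Q_sub: "Q \<subseteq> P" by (auto simp: Q_def)
  have g_all: "g p \<in> P - Q \<and> g (g p) = p \<and> g p \<noteq> p" if "p \<in> P - Q" for p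
  proof -
    obtain w i where p: "p = (w, i)" by (cases p)
    have w: "w \<in> signed_words ?n" "int ?n \<in> set w" and i: "i < ?n"
      and alt: "alternating_mset True (labels w ({..<?n} - {i}))"
      and nQ: "i = m \<Longrightarrow> w ! m \<noteq> int ?n"
      using that p by (auto simp: P_def Q_def H_def F_def)
    have len: "length w = ?n" using length_signed_words w(1) by blast
    have dist: "distinct w" using w(1) distinct_map by (auto simp: signed_words_def)
    show ?thesis
    proof (cases "i < m")
      case True
      let ?w = "w[i := w ! Suc i, Suc i := w ! i]"
      have gp: "g p = (?w, i)" using True by (simp add: p g_def)
      have "labels ?w ({..<?n} - {i}) = labels w ({..<?n} - {i})"
        using True len by (intro labels_cong set_take_swap) auto
      moreover have "?w \<in> signed_words ?n" using swap_signed_words[OF w(1)] True by simp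
      moreover have "set ?w = set w" using True len by (simp add: set_swap)
      ultimately have "g p \<in> P - Q" using gp w(2) i alt True by (auto simp: P_def Q_def H_def F_def)
      moreover have "?w \<noteq> w"
      proof
        assume "?w = w"
        then have "?w ! i = w ! i" by simp
        then have "w ! i = w ! Suc i" using True len by simp
        then show False using dist True len by (simp add: nth_eq_iff_index_eq)
      qed
      moreover have "?w[i := ?w ! Suc i, Suc i := ?w ! i] = w"
        using True len by (intro nth_equalityI) (auto simp: nth_list_update)
      ultimately show ?thesis using gp True by (simp add: p g_def)
    next
      case False
      then have im: "i = m" using i by simp
      let ?w = "w[m := - w ! m]"
      have gp: "g p = (?w, m)" using False by (simp add: p g_def)
      have "labels ?w ({..<?n} - {m}) = labels w ({..<?n} - {m})"
        by (intro labels_cong) (auto simp: take_update_cancel less_Suc_eq)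
      moreover have sw: "?w \<in> signed_words ?n" using flip_signed_words[OF w(1)] by simp
      moreover have "int ?n \<in> set ?w"
      proof -
        obtain j where j: "j < ?n" "w ! j = int ?n" using w(2) len by (metis in_set_conv_nth)
        then have "j \<noteq> m" using nQ im by auto
        then have "?w ! j = int ?n" using j by simp
        then show ?thesis using j len by (metis length_list_update nth_mem)
      qed
      moreover have "?w ! m \<noteq> int ?n"
      proof
        assume "?w ! m = int ?n"
        then have 1: "\<bar>w ! m\<bar> = int ?n" using len by simp
        obtain j where j: "j < ?n" "w ! j = int ?n" using w(2) len by (metis in_set_conv_nth)
        then have "map abs w ! j = map abs w ! m" using 1 len by simp
        then have "j = m" using w(1) j len nth_eq_iff_index_eq[of "map abs w" j m] by (simp add: signed_words_def)
        then show False using j nQ im by simp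
      qed
      ultimately have "g p \<in> P - Q" using gp im alt by (auto simp: P_def Q_def H_def F_def)
      moreover have "?w \<noteq> w"
      proof
        assume "?w = w"
        then have "- w ! m = w ! m" using len by (metis lessI nth_list_update_eq)
        then have "w ! m = 0" by simp
        moreover have "w ! m \<in> set w" using len by simp
        ultimately have "0 \<in> set (map abs w)" by force
        then show False using w(1) by (auto simp: signed_words_def)
      qed
      ultimately show ?thesis using gp len by (simp add: p g_def im)
    qed
  qed
  have "even (card (P - Q))"
    using finP g_all by (intro even_card_involution[of _ g]) auto
  moreover have "card P = card (P - Q) + card Q"
    using Q_sub finP by (metis card_Diff_subset card_mono finite_subset le_add_diff_inverse2)
  moreover have "card Q = card (alternating_words m)"
  proof -
    have Qeq: "Q = (\<lambda>w. (w @ [int ?n], m)) ` alternating_words m"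
    proof (intro set_eqI iffI)
      fix p assume "p \<in> Q"
      then obtain w where p: "p = (w, m)" "w \<in> signed_words ?n" "w ! m = int ?n"
        and alt: "alternating_mset True (labels w ({..<?n} - {m}))"
        by (auto simp: Q_def P_def H_def F_def)
      have len: "length w = ?n" using length_signed_words p(2) by blast
      define v where "v = take m w"
      have wv: "w = v @ [int ?n]" using len p(3) take_Suc_conv_app_nth[of m w] by (simp add: v_def)
      have "length v = m" using len by (simp add: v_def)
      then have "labels w ({..<?n} - {m}) = labels v {..<m}"
        unfolding wv by (rule labels_append)
      moreover have "v \<in> signed_words m" using signed_words_append_iff p(2) wv by blast
      ultimately show "p \<in> (\<lambda>w. (w @ [int ?n], m)) ` alternating_words m"
        using p(1) wv alt by (auto simp: alternating_words_def)
    next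
      fix p assume "p \<in> (\<lambda>w. (w @ [int ?n], m)) ` alternating_words m"
      then obtain v where p: "p = (v @ [int ?n], m)" "v \<in> signed_words m"
        and alt: "alternating_mset True (labels v {..<m})"
        by (auto simp: alternating_words_def)
      have len: "length v = m" using length_signed_words p(2) by blast
      have "labels (v @ [int ?n]) ({..<?n} - {m}) = labels v {..<m}"
        using labels_append[OF len] by simp
      moreover have "v @ [int ?n] \<in> signed_words ?n" using signed_words_append_iff p(2) by blast
      ultimately show "p \<in> Q" using p(1) alt len by (auto simp: Q_def P_def H_def F_def nth_append)
    qed
    show ?thesis unfolding Qeq by (rule card_image) (auto simp: inj_on_def)
  qed
  ultimately have oddP: "odd (card P)" using odd by simp
  \<comment> \<open>The second count goes simplex by simplex: an odd number of alternating facets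
    means that the simplex itself alternates, from either starting sign.\<close>
  have "card P = (\<Sum>w\<in>H. card (F w))"
    unfolding P_def using finH by (intro card_SigmaI) (auto simp: F_def)
  then have 1: "odd (card {w \<in> H. odd (card (F w))})"
    using oddP even_sum_iff[OF finH, of "\<lambda>w. card (F w)"] by simp
  define A where "A = (\<lambda>b. {w \<in> H. alternating_mset b (labels w {..<?n})})"
  have "{w \<in> H. odd (card (F w))} = A True \<union> A False"
    using even_card_alternating_facets[OF _ m, of _ True] not_alternating_both[OF _ m, of _ True]
    by (auto simp: A_def F_def H_def)
  moreover have disj: "A True \<inter> A False = {}"
    using not_alternating_both[OF _ m, of _ True] by (auto simp: A_def H_def)
  moreover have finA: "finite (A b)" for b using finH by (simp add: A_def)
  ultimately have 2: "odd (card (A True) + card (A False))"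
    using 1 card_Un_disjoint[of "A True" "A False"] by simp
  \<comment> \<open>The antipodal map turns the simplices of the hemisphere that start negatively
    into those of the opposite hemisphere that start positively. With \<open>A True\<close> these
    exhaust \<open>alternating_words ?n\<close>.\<close>
  have B: "map uminus ` A False = {w \<in> alternating_words ?n. - int ?n \<in> set w}" (is "?L = ?B")
  proof (intro set_eqI iffI)
    fix v assume "v \<in> ?L"
    then obtain w where w: "w \<in> signed_words ?n" "int ?n \<in> set w" "v = map uminus w"
      "alternating_mset False (labels w {..<?n})" by (auto simp: A_def H_def)
    then have "alternating_mset True (labels v {..<?n})"
      using labels_map_uminus[OF w(1) m] alternating_mset_uminus[OF no_opposites_labels[OF w(1) m order_refl], of True] by simp
    moreover have "- int ?n \<in> set v" using imageI[OF w(2), of uminus] w(3) by simp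
    ultimately show "v \<in> ?B" using w(3) map_uminus_signed_words[OF w(1)]
      by (simp add: alternating_words_def)
  next
    fix v assume "v \<in> ?B"
    then have v: "v \<in> signed_words ?n" "- int ?n \<in> set v"
      "alternating_mset True (labels v {..<?n})" by (auto simp: alternating_words_def)
    then have "alternating_mset False (labels (map uminus v) {..<?n})"
      using labels_map_uminus[OF v(1) m] alternating_mset_uminus[OF no_opposites_labels[OF v(1) m order_refl], of False] by simp
    moreover have "int ?n \<in> set (map uminus v)" using v(2) by force
    ultimately have "map uminus v \<in> A False"
      using map_uminus_signed_words[OF v(1)] by (auto simp: A_def H_def)
    moreover have "v = map uminus (map uminus v)" by (simp add: comp_def)
    ultimately show "v \<in> ?L" by blast
  qed
  have "card (A False) = card ?B"
    unfolding B[symmetric] by (rule card_image[symmetric]) (auto simp: inj_on_def intro: map_injective)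
  moreover have "alternating_words ?n = A True \<union> ?B"
  proof -
    have "int ?n \<in> set w \<or> - int ?n \<in> set w" if "w \<in> signed_words ?n" for w
    proof -
      have "int ?n \<in> set (map abs w)" using that by (simp add: signed_words_def)
      then obtain x where "x \<in> set w" "\<bar>x\<bar> = int ?n" by auto
      then have "x = int ?n \<or> x = - int ?n" by linarith
      then show ?thesis using \<open>x \<in> set w\<close> by blast
    qed
    then show ?thesis by (auto simp: alternating_words_def A_def H_def)
  qed
  moreover have "A True \<inter> ?B = {}"
  proof -
    have False if w: "w \<in> signed_words ?n" "int ?n \<in> set w" "- int ?n \<in> set w" for w
    proof -
      have "inj_on abs (set w)" using w(1) by (simp add: signed_words_def distinct_map)
      then have "int ?n = - int ?n" by (rule inj_onD) (use w in simp_all)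
      then show False by simp
    qed
    then show ?thesis by (auto simp: A_def H_def)
  qed
  moreover have "finite ?B" unfolding B[symmetric] using finA by simp
  ultimately show ?thesis using 2 finA card_Un_disjoint[of "A True" ?B] by simp
qed

text \<open>Fan's theorem by induction on the dimension. For \<open>n = 0\<close> the empty word is
  the only simplex, and it alternates vacuously.\<close>

lemma odd_card_alternating_words: "n \<le> N \<Longrightarrow> odd (card (alternating_words n))"
proof (induction n)
  case 0
  have "signed_words 0 = {[]}" by (auto simp: signed_words_def)
  moreover have "sorted_by_abs {#} = []"
    using sorted_by_abs_eqI[of "[]"] by (simp add: no_opposites_def)
  ultimately have "alternating_words 0 = {[]}"
    by (auto simp: alternating_words_def labels_def alternating_mset_def)
  then show ?case by simp
next
  case (Suc m)
  then show ?case using odd_card_alternating_words_Suc by simp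
qed

text \<open>Tucker's lemma: an odd count is not 0, so an alternating word exists, and its
  \<open>N\<close> labels have distinct absolute values between 1 and \<open>m\<close>.\<close>

theorem dimension_le_labels:
  assumes "\<And>X. X \<in> signed_sets N \<Longrightarrow> \<bar>l X\<bar> \<le> int m"
  shows "N \<le> m"
proof -
  have "card (alternating_words N) \<noteq> 0"
    using odd_card_alternating_words[OF order_refl] by (metis even_zero)
  then obtain w where w: "w \<in> signed_words N" "alternating_mset True (labels w {..<N})"
    by (auto simp: alternating_words_def card_eq_0_iff)
  have "size (labels w {..<N}) \<le> m"
  proof (rule size_alternating_mset_le[OF no_opposites_labels[OF w(1) order_refl order_refl] w(2)])
    fix x assume "x \<in># labels w {..<N}"
    then obtain j where "j < N" "x = l (set (take (Suc j) w))" by (auto simp: labels_def)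
    then show "\<bar>x\<bar> \<le> int m" using assms set_prefix_in_signed_sets[OF w(1) order_refl] by blast
  qed
  then show ?thesis by (simp add: labels_def)
qed

end

section \<open>Disjoint sets sharing a colour\<close>

text \<open>The set of coordinates with a plus. Those with a minus are the \<open>pos_part\<close>
  of the negated set.\<close>

definition pos_part :: "int set \<Rightarrow> nat set" where
  "pos_part X = nat ` {x \<in> X. x > 0}"

lemma mem_pos_part_iff: "i \<in> pos_part X \<longleftrightarrow> i > 0 \<and> int i \<in> X"
  by (force simp: pos_part_def)

lemma mem_pos_part_uminus_iff: "i \<in> pos_part (uminus ` X) \<longleftrightarrow> i > 0 \<and> - int i \<in> X"
  by (force simp: mem_pos_part_iff)

lemma uminus_in_signed_sets: "X \<in> signed_sets n \<Longrightarrow> uminus ` X \<in> signed_sets n"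
  by (force simp: signed_sets_def)

lemma finite_signed_sets: "X \<in> signed_sets n \<Longrightarrow> finite X"
  by (auto simp: signed_sets_def intro: finite_subset)

lemma zero_notin_signed_sets: "X \<in> signed_sets n \<Longrightarrow> 0 \<notin> X"
  by (auto simp: signed_sets_def)

lemma pos_part_subset: "X \<in> signed_sets n \<Longrightarrow> pos_part X \<subseteq> {1..n}"
  by (force simp: signed_sets_def mem_pos_part_iff)

lemma pos_part_disjoint:
  assumes "Y \<in> signed_sets n" "X \<subseteq> Y"
  shows "pos_part X \<inter> pos_part (uminus ` Y) = {}"
proof -
  have "- int i \<notin> Y" if "int i \<in> X" for i
    using assms that by (auto simp: signed_sets_def)
  then show ?thesis
    by (simp add: disjoint_iff mem_pos_part_uminus_iff mem_pos_part_iff[of _ X])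
qed

lemma card_pos_parts:
  assumes "X \<in> signed_sets n"
  shows "card X = card (pos_part X) + card (pos_part (uminus ` X))"
proof -
  have fin: "finite X" using finite_signed_sets[OF assms] .
  have "X = int ` pos_part X \<union> (\<lambda>i. - int i) ` pos_part (uminus ` X)"
  proof (intro set_eqI iffI)
    fix x assume x: "x \<in> X"
    then have "x \<noteq> 0" using zero_notin_signed_sets[OF assms] by auto
    then consider "x > 0" | "x < 0" by linarith
    then show "x \<in> int ` pos_part X \<union> (\<lambda>i. - int i) ` pos_part (uminus ` X)"
    proof cases
      case 1
      then have "nat x \<in> pos_part X" "x = int (nat x)" using x by (auto simp: mem_pos_part_iff)
      then show ?thesis by blast
    next
      case 2
      then have "nat (- x) \<in> pos_part (uminus ` X)" "x = - int (nat (- x))"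
        using x by (auto simp: mem_pos_part_uminus_iff)
      then show ?thesis by blast
    qed
  next
    fix x assume "x \<in> int ` pos_part X \<union> (\<lambda>i. - int i) ` pos_part (uminus ` X)"
    then show "x \<in> X" by (auto simp: mem_pos_part_iff mem_pos_part_uminus_iff)
  qed
  moreover have "int ` pos_part X \<inter> (\<lambda>i. - int i) ` pos_part (uminus ` X) = {}"
    by (auto simp: mem_pos_part_iff mem_pos_part_uminus_iff)
  moreover have "finite (pos_part X)" "finite (pos_part (uminus ` X))"
    using fin by (auto simp: pos_part_def)
  ultimately have "card X = card (int ` pos_part X) + card ((\<lambda>i. - int i) ` pos_part (uminus ` X))"
    by (metis card_Un_disjoint finite_imageI)
  then show ?thesis by (simp add: card_image inj_on_def)
qed

text \<open>Matousek's labelling: small signed sets are labelled by their size and the sign of their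
  element of least absolute value, large ones by a colour of one of their two parts.\<close>

lemma ex_disjoint_same_colour:
  fixes P :: "nat \<Rightarrow> nat set \<Rightarrow> bool"
  assumes pop: "\<And>S. S \<subseteq> {1..n} \<Longrightarrow> card S \<ge> M \<Longrightarrow> \<exists>c\<in>{1..d}. P c S"
    and M: "M \<ge> 1" "2 * M + d < n + 2"
  shows "\<exists>c\<in>{1..d}. \<exists>S T. S \<subseteq> {1..n} \<and> T \<subseteq> {1..n} \<and> S \<inter> T = {} \<and> P c S \<and> P c T"
proof (rule ccontr)
  assume contra: "\<not> ?thesis"
  \<comment> \<open>The condition is symmetric in the two parts, so \<open>X\<close> and its
    negative receive the same colour.\<close>
  define colour where "colour X = (LEAST c. c \<in> {1..d} \<and> (P c (pos_part X) \<or> P c (pos_part (uminus ` X))))" for X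
  \<comment> \<open>Beyond size \<open>2 * M - 2\<close> one of the parts has at least
    \<open>M\<close> elements. Adding \<open>2 * M - 2\<close> to the colour keeps the absolute
    values of the two kinds of labels apart.\<close>
  define l where "l X = (if card X \<le> 2 * M - 2
      then (if Min (abs ` X) \<in> X then 1 else - 1) * int (card X)
      else (if P (colour X) (pos_part X) then 1 else - 1) * int (2 * M - 2 + colour X))" for X
  have colour: "colour X \<in> {1..d} \<and> (P (colour X) (pos_part X) \<or> P (colour X) (pos_part (uminus ` X)))"
    if X: "X \<in> signed_sets n" "\<not> card X \<le> 2 * M - 2" for X
  proof -
    have "card (pos_part X) \<ge> M \<or> card (pos_part (uminus ` X)) \<ge> M"
      using card_pos_parts[OF X(1)] X(2) M(1) by linarith
    then have "\<exists>c. c \<in> {1..d} \<and> (P c (pos_part X) \<or> P c (pos_part (uminus ` X)))"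
      using pop pos_part_subset X(1) uminus_in_signed_sets by metis
    then show ?thesis unfolding colour_def by (rule LeastI_ex)
  qed
  have colour_uminus: "colour (uminus ` X) = colour X" for X
    unfolding colour_def by (simp add: image_image disj_commute)
  \<comment> \<open>Opposite parts of nested signed sets are disjoint, so a common colour is ruled
    out by \<open>contra\<close>.\<close>
  have excl: "\<not> (P c (pos_part X) \<and> P c (pos_part (uminus ` Y)))"
    if "X \<in> signed_sets n" "Y \<in> signed_sets n" "X \<subseteq> Y" "c \<in> {1..d}" for c X Y
    using contra that pos_part_subset[OF that(1)] pos_part_subset[OF uminus_in_signed_sets[OF that(2)]]
      pos_part_disjoint[OF that(2,3)] by blast
  have cardX: "card X > 0" if "X \<in> signed_sets n" for X
    using that finite_signed_sets by (auto simp: card_gt_0_iff signed_sets_def)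
  have card_uminus: "card (uminus ` X) = card X" for X :: "int set"
    by (simp add: card_image)
  have antip: "l (uminus ` X) = - l X" if X: "X \<in> signed_sets n" for X
  proof (cases "card X \<le> 2 * M - 2")
    case True
    have "Min (abs ` X) \<in> abs ` X"
      using finite_signed_sets[OF X] X by (intro Min_in) (auto simp: signed_sets_def)
    then obtain x where x: "x \<in> X" "Min (abs ` X) = \<bar>x\<bar>" by auto
    have "abs ` uminus ` X = abs ` X" by (simp add: image_image)
    moreover have "\<bar>x\<bar> \<in> uminus ` X \<longleftrightarrow> - \<bar>x\<bar> \<in> X" by force
    moreover have "- \<bar>x\<bar> \<in> X \<longleftrightarrow> \<bar>x\<bar> \<notin> X"
      using x X by (auto simp: signed_sets_def abs_if)
    ultimately show ?thesis using x(2) True card_uminus[of X] by (simp add: l_def)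
  next
    case False
    let ?c = "colour X"
    have "P ?c (pos_part (uminus ` X)) \<longleftrightarrow> \<not> P ?c (pos_part X)"
      using colour[OF X False] excl[OF X X order_refl] by blast
    then show ?thesis using False card_uminus[of X] colour_uminus[of X] by (simp add: l_def)
  qed
  have abs1: "\<bar>l X\<bar> = int (card X)" if "card X \<le> 2 * M - 2" for X
    using that by (simp add: l_def abs_mult)
  have abs2: "\<bar>l X\<bar> = int (2 * M - 2 + colour X)" if "\<not> card X \<le> 2 * M - 2" for X
    using that by (simp add: l_def abs_mult)
  have nz: "l X \<noteq> 0" if X: "X \<in> signed_sets n" for X
    using abs1[of X] abs2[of X] colour[OF X] cardX[OF X] by (cases "card X \<le> 2 * M - 2") auto
  have "tucker_labelling n l"
  proof
    fix X Y assume X: "X \<in> signed_sets n" and Y: "Y \<in> signed_sets n" and sub: "X \<subseteq> Y"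
    show "l X \<noteq> - l Y"
    proof
      assume eq: "l X = - l Y"
      then have abs: "\<bar>l X\<bar> = \<bar>l Y\<bar>" by simp
      have le: "card X \<le> card Y" using sub finite_signed_sets[OF Y] by (rule card_mono[rotated])
      show False
      proof (cases "card Y \<le> 2 * M - 2")
        case True
        then have "card X = card Y" using abs abs1 le by simp
        then have "X = Y" using sub finite_signed_sets[OF Y] by (metis card_subset_eq)
        then show False using eq nz[OF Y] by simp
      next
        case False
        have XF: "\<not> card X \<le> 2 * M - 2"
        proof
          assume "card X \<le> 2 * M - 2"
          then have "card X = 2 * M - 2 + colour Y" "card X \<le> 2 * M - 2"
            using abs abs1[of X] abs2[OF False] by linarith+
          then show False using colour[OF Y False] by simp
        qed
        have c: "colour X = colour Y" using abs abs2[OF XF] abs2[OF False] by simp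
        let ?c = "colour Y"
        have cd: "?c \<in> {1..d}" "int (2 * M - 2 + ?c) > 0" using colour[OF Y False] by auto
        \<comment> \<open>Opposite labels put the common colour on the positive part of exactly one
          of \<open>X\<close> and \<open>Y\<close>, hence on the negative part of the other; these
          parts are disjoint.\<close>
        have "P ?c (pos_part X) \<longleftrightarrow> \<not> P ?c (pos_part Y)"
          using eq XF False cd c by (auto simp: l_def split: if_splits)
        moreover have "P ?c (pos_part X) \<or> P ?c (pos_part (uminus ` X))" using colour[OF X XF] c by simp
        moreover have "P ?c (pos_part Y) \<or> P ?c (pos_part (uminus ` Y))" using colour[OF Y False] by simp
        moreover have "\<not> (P ?c (pos_part X) \<and> P ?c (pos_part (uminus ` Y)))"
          using excl[OF X Y sub cd(1)] .
        moreover have "\<not> (P ?c (pos_part (uminus ` X)) \<and> P ?c (pos_part Y))"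
          using excl[OF uminus_in_signed_sets[OF X] uminus_in_signed_sets[OF Y] image_mono[OF sub] cd(1)]
          by (simp add: image_image)
        ultimately show False by blast
      qed
    qed
  qed (rule antip)
  then interpret tucker_labelling n l .
  have "n \<le> 2 * M - 2 + d"
  proof (rule dimension_le_labels)
    fix X assume X: "X \<in> signed_sets n"
    show "\<bar>l X\<bar> \<le> int (2 * M - 2 + d)"
      using abs1[of X] abs2[of X] colour[OF X] by (cases "card X \<le> 2 * M - 2") auto
  qed
  then show False using M by linarith
qed

section \<open>Acyclic orientations and directed bicliques\<close>

text \<open>A closed walk contains a cycle, which links acyclicity of a digraph to that of its arc
  relation.\<close>

lemma acyclic_induced_arcs:
  assumes D: "pair_wf_digraph D" and ac: "acyclic_digraph (with_proj D \<restriction> C)"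
  shows "acyclic (parcs D \<inter> C \<times> C)"
proof -
  let ?H = "with_proj D \<restriction> C"
  have "wf_digraph (with_proj D)" using D by (simp add: wf_digraph_wp_iff)
  then interpret H: wf_digraph ?H by (rule wf_digraph.wellformed_induce_subgraph)
  have ends: "arcs_ends ?H = parcs D \<inter> C \<times> C"
    by (auto simp: arcs_ends_def arc_to_ends_def)
  have "(v, v) \<notin> (parcs D \<inter> C \<times> C)\<^sup>+" for v
  proof
    assume "(v, v) \<in> (parcs D \<inter> C \<times> C)\<^sup>+"
    then have "\<exists>p. H.awalk v p v \<and> p \<noteq> []" using H.reachable1_awalk ends by simp
    then obtain p where "H.closed_w p" by (auto simp: H.closed_w_def)
    then show False using H.closed_w_imp_cycle ac by (auto simp: acyclic_digraph_def)
  qed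
  then show ?thesis by (auto simp: acyclic_def)
qed

text \<open>\<open>h u\<close> counts the strict ancestors of \<open>u\<close>. Along an arc from
  \<open>u\<close> to \<open>v\<close> they are inherited, and \<open>u\<close> itself is
  added.\<close>

lemma acyclic_imp_increasing_map:
  assumes "finite R" "acyclic R"
  obtains h :: "'a \<Rightarrow> nat" where "\<And>u v. (u, v) \<in> R \<Longrightarrow> h u < h v"
proof
  let ?P = "\<lambda>u. {w. (w, u) \<in> R\<^sup>+}"
  fix u v assume uv: "(u, v) \<in> R"
  have "?P v \<subseteq> Domain R" using trancl_domain[of R] by blast
  then have "finite (?P v)" using assms(1) by (metis finite_Domain finite_subset)
  moreover have "?P u \<subseteq> ?P v" using uv by auto
  moreover have "u \<in> ?P v" "u \<notin> ?P u" using uv assms(2) by (auto simp: acyclic_def)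
  ultimately show "card (?P u) < card (?P v)" by (intro psubset_card_mono) auto
qed

text \<open>At the first height \<open>t\<close> where one side has \<open>r\<close> vertices at or
  below \<open>t\<close>, the other side still has at least \<open>r\<close> above \<open>t\<close>.
  All arcs between these two sets point upwards.\<close>

lemma acyclic_bipartite_contains_directed_biclique:
  assumes R: "finite R" "acyclic R" and fin: "finite A" "finite B"
    and card: "card A \<ge> 2 * r" "card B \<ge> 2 * r" and r: "r \<ge> 1"
    and adj: "\<And>a b. a \<in> A \<Longrightarrow> b \<in> B \<Longrightarrow> (a, b) \<in> R \<or> (b, a) \<in> R"
  obtains S T where "card S = r" "card T = r" "S \<times> T \<subseteq> R"
    "S \<subseteq> A \<and> T \<subseteq> B \<or> S \<subseteq> B \<and> T \<subseteq> A"
proof -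
  obtain h :: "'a \<Rightarrow> nat" where h: "\<And>u v. (u, v) \<in> R \<Longrightarrow> h u < h v"
    using acyclic_imp_increasing_map[OF R] by blast
  define low where "low X t = {x \<in> X. h x \<le> t}" for X t
  let ?Q = "\<lambda>t. card (low A t) \<ge> r \<or> card (low B t) \<ge> r"
  define t where "t = (LEAST t. ?Q t)"
  have ex: "?Q (Max (h ` A))"
  proof -
    have "low A (Max (h ` A)) = A" using fin(1) by (auto simp: low_def)
    then show ?thesis using card(1) by simp
  qed
  have Qt: "?Q t" unfolding t_def using ex by (rule LeastI)
  \<comment> \<open>Stated for arbitrary sides so that it serves both cases; the local
    \<open>fin\<close> hides which side is the lower one.\<close>
  have main: thesis if A: "finite A" "card A \<ge> 2 * r" "finite B" "card B \<ge> 2 * r"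
    and adj: "\<And>a b. a \<in> A \<Longrightarrow> b \<in> B \<Longrightarrow> (a, b) \<in> R \<or> (b, a) \<in> R"
    and Q: "card (low A t) \<ge> r" and nB: "\<And>b. b \<in> B \<Longrightarrow> h b \<noteq> t"
    and min: "\<And>s. s < t \<Longrightarrow> card (low B s) < r"
    and fin: "\<And>S T. card S = r \<Longrightarrow> card T = r \<Longrightarrow> S \<times> T \<subseteq> R \<Longrightarrow> S \<subseteq> A \<Longrightarrow> T \<subseteq> B \<Longrightarrow> thesis"
    for A B
  proof -
    \<comment> \<open>Minimality bounds \<open>B\<close> only strictly below \<open>t\<close>. As
      \<open>B\<close> has no vertex at height \<open>t\<close>, the bound extends to
      \<open>t\<close>.\<close>
    have "card (low B t) < r"
    proof (cases t)
      case 0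
      then have "low B t = {}" using nB by (auto simp: low_def)
      then show ?thesis using r by simp
    next
      case (Suc s)
      then have "low B t = low B s" using nB by (auto simp: low_def le_Suc_eq)
      then show ?thesis using min Suc by simp
    qed
    moreover have "card (B - low B t) = card B - card (low B t)"
      using A by (intro card_Diff_subset) (auto simp: low_def)
    ultimately have "card (B - low B t) \<ge> r" using A by linarith
    then obtain T where T: "T \<subseteq> B - low B t" "card T = r" using obtain_subset_with_card_n by metis
    obtain S where S: "S \<subseteq> low A t" "card S = r" using Q obtain_subset_with_card_n by metis
    have "S \<times> T \<subseteq> R"
    proof (safe)
      fix a b assume ab: "a \<in> S" "b \<in> T"
      then have "a \<in> A" "h a \<le> t" "b \<in> B" "\<not> h b \<le> t" using S T by (auto simp: low_def)
      then show "(a, b) \<in> R" using adj[of a b] h[of b a] by auto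
    qed
    moreover have "S \<subseteq> A" "T \<subseteq> B" using S(1) T(1) by (auto simp: low_def)
    ultimately show thesis using fin S(2) T(2) by blast
  qed
  have min: "card (low A s) < r" "card (low B s) < r" if "s < t" for s
    using not_less_Least[of s ?Q] that unfolding t_def by auto
  have tie: "h a \<noteq> h b" if "a \<in> A" "b \<in> B" for a b
    using adj[OF that] h by fastforce
  \<comment> \<open>The side that reaches \<open>r\<close> has a vertex at height exactly
    \<open>t\<close>; by \<open>tie\<close> the other side then has none there.\<close>
  have sub: "\<exists>x\<in>X. h x = t" if "card (low X t) \<ge> r" "\<And>s. s < t \<Longrightarrow> card (low X s) < r" for X
  proof (rule ccontr)
    assume n: "\<not> ?thesis"
    show False
    proof (cases t)
      case 0
      then have "low X t = {}" using n by (auto simp: low_def)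
      then show ?thesis using r that(1) by simp
    next
      case (Suc s)
      then have "low X t = low X s" using n by (auto simp: low_def le_Suc_eq)
      then show ?thesis using that Suc by (metis lessI not_less)
    qed
  qed
  from Qt show thesis
  proof
    assume Q: "card (low A t) \<ge> r"
    then obtain a where a: "a \<in> A" "h a = t" using sub min by blast
    show thesis
      by (rule main[of A B]) (use fin card adj Q a tie min that in fastforce)+
  next
    assume Q: "card (low B t) \<ge> r"
    then obtain a where a: "a \<in> B" "h a = t" using sub min by blast
    show thesis
      by (rule main[of B A]) (use fin card adj Q a tie min that in fastforce)+
  qed
qed

section \<open>Counting orientations\<close>

text \<open>Once \<open>F \<inter> Q\<close> is fixed, \<open>F\<close> is determined by
  \<open>F - Q\<close>. The product form avoids subtraction in the exponent.\<close>

lemma card_subsets_prescribed: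
  assumes "finite E" "Q \<subseteq> E"
  shows "card {F. F \<subseteq> E \<and> F \<inter> Q = Z} * 2 ^ card Q \<le> 2 ^ card E"
proof -
  have finQ: "finite Q" using assms finite_subset by blast
  have "card {F. F \<subseteq> E \<and> F \<inter> Q = Z} \<le> card (Pow (E - Q))"
  proof (rule card_inj_on_le[of "\<lambda>F. F - Q"])
    show "inj_on (\<lambda>F. F - Q) {F. F \<subseteq> E \<and> F \<inter> Q = Z}" by (rule inj_onI) blast
  qed (use assms in auto)
  also have "\<dots> = 2 ^ (card E - card Q)"
    using assms finQ by (simp add: card_Pow card_Diff_subset)
  finally have "card {F. F \<subseteq> E \<and> F \<inter> Q = Z} * 2 ^ card Q \<le> 2 ^ (card E - card Q) * 2 ^ card Q"
    by (rule mult_right_mono) simp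
  also have "\<dots> = 2 ^ card E"
    using card_mono[OF assms] by (simp flip: power_add)
  finally show ?thesis .
qed

text \<open>A union bound in counting form: with \<open>N\<close> vertices there are at most
  \<open>(N ^ 2) ^ r\<close> pairs of \<open>r\<close>-sets, and each is a directed biclique in at
  most one out of \<open>(2 ^ r) ^ r\<close> orientations.\<close>

lemma (in pair_graph) ex_orientation_without_directed_biclique:
  assumes N: "card (pverts G) ^ 2 < 2 ^ r" and r: "r \<ge> 1"
  shows "\<exists>D. orientation D G \<and>
    (\<forall>S T. card S = r \<longrightarrow> card T = r \<longrightarrow> \<not> S \<times> T \<subseteq> parcs D)"
proof -
  let ?V = "pverts G" let ?N = "card (pverts G)"
  obtain h :: "'a \<Rightarrow> nat" where h: "inj_on h ?V"
    using finite_imp_inj_to_nat_seg[OF pair_finite_verts] by blast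
  have opp: "(v, u) \<in> parcs G" if "(u, v) \<in> parcs G" for u v
    using that pair_sym_arcs by (auto simp: symmetric_def sym_def)
  have hne: "h u \<noteq> h v" if "(u, v) \<in> parcs G" for u v
  proof
    assume "h u = h v"
    then have "u = v" using inj_onD[OF h] in_arcsD1[OF that] in_arcsD2[OF that] by simp
    then show False using pair_no_loops[OF that] by simp
  qed
  \<comment> \<open>A reference orientation; \<open>ori F\<close> keeps its arcs in \<open>F\<close>
    and reverses the others.\<close>
  define E where "E = {(u, v) \<in> parcs G. h u < h v}"
  have finE: "finite E" using pair_finite_arcs by (auto simp: E_def intro: finite_subset)
  have asym: "(b, a) \<notin> E" if "(a, b) \<in> E" for a b using that by (auto simp: E_def)
  define ori where "ori F = F \<union> (E - F)\<inverse>" for F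
  have ori: "orientation \<lparr>pverts = ?V, parcs = ori F\<rparr> G" if "F \<subseteq> E" for F
  proof -
    have "ori F \<union> (ori F)\<inverse> = E \<union> E\<inverse>" using that by (auto simp: ori_def)
    moreover have "E \<union> E\<inverse> = parcs G" using opp hne by (auto simp: E_def neq_iff)
    moreover have "ori F \<inter> (ori F)\<inverse> = {}" using that asym unfolding ori_def by blast
    ultimately show ?thesis by (simp add: orientation_def)
  qed
  define bad where "bad = (\<lambda>(S, T). {F. F \<subseteq> E \<and> S \<times> T \<subseteq> ori F})"
  define \<S> where "\<S> = {S. S \<subseteq> ?V \<and> card S = r}"
  have fin\<S>: "finite \<S>" using pair_finite_verts by (auto simp: \<S>_def)
  have card_bad: "card (bad p) * 2 ^ (r * r) \<le> 2 ^ card E" if pS: "p \<in> \<S> \<times> \<S>" for p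
  proof (cases "bad p = {}")
    case True
    then show ?thesis by simp
  next
    case False
    obtain S T where p: "p = (S, T)" "card S = r" "card T = r" using pS by (cases p) (auto simp: \<S>_def)
    obtain F0 where "F0 \<subseteq> E" "S \<times> T \<subseteq> ori F0" using False by (auto simp: bad_def p)
    then have sub: "S \<times> T \<subseteq> E \<union> E\<inverse>" by (auto simp: ori_def)
    \<comment> \<open>Otherwise \<open>S\<close> and \<open>T\<close> would meet and produce a loop.
      Hence the pairs in \<open>S \<times> T\<close> use \<open>r * r\<close> distinct
      edges.\<close>
    have disj: "(b, a) \<notin> S \<times> T" if "(a, b) \<in> S \<times> T" for a b
    proof
      assume "(b, a) \<in> S \<times> T"
      then have "(a, a) \<in> S \<times> T" using that by blast
      then show False using sub by (auto simp: E_def)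
    qed
    define Q where "Q = E \<inter> (S \<times> T \<union> (S \<times> T)\<inverse>)"
    let ?f = "\<lambda>(a, b). if (a, b) \<in> E then (a, b) else (b, a)"
    have "card (S \<times> T) \<le> card Q"
    proof (rule card_inj_on_le[of ?f])
      show "inj_on ?f (S \<times> T)"
        using disj by (fastforce simp: inj_on_def split: if_splits)
      show "?f ` (S \<times> T) \<subseteq> Q" using sub by (auto simp: Q_def split: if_splits)
      show "finite Q" using finE by (simp add: Q_def)
    qed
    then have "r * r \<le> card Q" using p by (simp add: card_cartesian_product)
    \<comment> \<open>A biclique from \<open>S\<close> to \<open>T\<close> dictates which arcs of
      \<open>Q\<close> are kept: exactly those already leading from \<open>S\<close> to
      \<open>T\<close>.\<close>
    have "bad p \<subseteq> {F. F \<subseteq> E \<and> F \<inter> Q = E \<inter> (S \<times> T)}"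
    proof
      fix F assume "F \<in> bad p"
      then have F: "F \<subseteq> E" "S \<times> T \<subseteq> ori F" by (auto simp: bad_def p)
      have "F \<inter> Q = E \<inter> (S \<times> T)"
      proof (intro set_eqI iffI)
        fix e assume e: "e \<in> F \<inter> Q"
        obtain a b where ab: "e = (a, b)" by (cases e)
        have "(a, b) \<in> E" "(a, b) \<in> F" using e F ab by auto
        moreover have "(a, b) \<in> S \<times> T"
        proof (rule ccontr)
          assume "(a, b) \<notin> S \<times> T"
          then have "(b, a) \<in> S \<times> T" using e ab by (auto simp: Q_def)
          then have "(b, a) \<in> ori F" using F by blast
          then show False using \<open>(a, b) \<in> F\<close> F(1) asym unfolding ori_def by blast
        qed
        ultimately show "e \<in> E \<inter> (S \<times> T)" using ab by blast
      next
        fix e assume e: "e \<in> E \<inter> (S \<times> T)"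
        then have "e \<in> ori F" using F by blast
        then have "e \<in> F" using e asym unfolding ori_def by blast
        then show "e \<in> F \<inter> Q" using e by (auto simp: Q_def)
      qed
      then show "F \<in> {F. F \<subseteq> E \<and> F \<inter> Q = E \<inter> (S \<times> T)}" using F by blast
    qed
    then have "card (bad p) \<le> card {F. F \<subseteq> E \<and> F \<inter> Q = E \<inter> (S \<times> T)}"
      using finE by (intro card_mono) auto
    then have "card (bad p) * 2 ^ (r * r) \<le> card {F. F \<subseteq> E \<and> F \<inter> Q = E \<inter> (S \<times> T)} * 2 ^ card Q"
      using \<open>r * r \<le> card Q\<close> by (intro mult_le_mono power_increasing) auto
    also have "\<dots> \<le> 2 ^ card E" by (rule card_subsets_prescribed[OF finE]) (simp add: Q_def)
    finally show ?thesis .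
  qed
  have card\<S>: "card \<S> \<le> ?N ^ r"
  proof -
    have "card \<S> = ?N choose r" using n_subsets[OF pair_finite_verts, of r] by (simp add: \<S>_def)
    also have "\<dots> \<le> ?N ^ r"
      by (cases "r \<le> ?N") (use binomial_le_pow in \<open>auto simp: binomial_eq_0\<close>)
    finally show ?thesis .
  qed
  have "card (\<Union>p\<in>\<S> \<times> \<S>. bad p) * 2 ^ (r * r) \<le> (\<Sum>p\<in>\<S> \<times> \<S>. card (bad p)) * 2 ^ (r * r)"
    using fin\<S> by (intro mult_right_mono card_UN_le) auto
  also have "\<dots> = (\<Sum>p\<in>\<S> \<times> \<S>. card (bad p) * 2 ^ (r * r))" by (rule sum_distrib_right)
  also have "\<dots> \<le> (\<Sum>p\<in>\<S> \<times> \<S>. 2 ^ card E)" by (rule sum_mono) (rule card_bad)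
  also have "\<dots> = card \<S> * card \<S> * 2 ^ card E" by (simp add: card_cartesian_product)
  also have "\<dots> \<le> ?N ^ r * ?N ^ r * 2 ^ card E" using card\<S> by (intro mult_le_mono) auto
  also have "\<dots> = (?N ^ 2) ^ r * 2 ^ card E"
    by (simp add: power2_eq_square power_mult_distrib)
  also have "\<dots> < (2 ^ r) ^ r * 2 ^ card E"
    using N r by (intro mult_strict_right_mono power_strict_mono) auto
  finally have "card (\<Union>p\<in>\<S> \<times> \<S>. bad p) * 2 ^ (r * r) < 2 ^ card E * 2 ^ (r * r)"
    by (simp add: power_mult mult.commute)
  then have "card (\<Union>p\<in>\<S> \<times> \<S>. bad p) < card (Pow E)" using finE by (simp add: card_Pow)
  moreover have "finite (\<Union>p\<in>\<S> \<times> \<S>. bad p)" using fin\<S> finE by (auto simp: bad_def)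
  ultimately have "\<not> Pow E \<subseteq> (\<Union>p\<in>\<S> \<times> \<S>. bad p)" by (meson card_mono not_le)
  then obtain F where F: "F \<subseteq> E" "F \<notin> (\<Union>p\<in>\<S> \<times> \<S>. bad p)" by blast
  have "\<not> S \<times> T \<subseteq> ori F" if ST: "card S = r" "card T = r" for S T
  proof
    assume sub: "S \<times> T \<subseteq> ori F"
    \<comment> \<open>\<open>S\<close> and \<open>T\<close> range over arbitrary sets; only when
      both are nonempty do the arcs force them into the vertex set.\<close>
    have "S \<noteq> {}" "T \<noteq> {}" using ST r by auto
    moreover have "S \<times> T \<subseteq> ?V \<times> ?V"
      using sub F(1) in_arcsD1 in_arcsD2 by (fastforce simp: ori_def E_def)
    ultimately have "S \<in> \<S>" "T \<in> \<S>" using ST by (auto simp: \<S>_def)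
    then show False using F sub by (auto simp: bad_def)
  qed
  then show ?thesis using ori[OF F(1)] by auto
qed

section \<open>Colourings and dicolourings of Kneser graphs\<close>

text \<open>Kneser's colouring by the least element, capped at \<open>n - 2 * k + 2\<close>. The
  sets with the capped colour lie in \<open>{n - 2 * k + 2..n}\<close>, which has
  \<open>2 * k - 1\<close> elements, so any two of them meet.\<close>

lemma chromatic_number_kneser_graph_le:
  assumes "k \<ge> 1" "2 * k \<le> n"
  shows "chromatic_number (kneser_graph n k) \<le> n - 2 * k + 2"
proof -
  let ?q = "n - 2 * k + 2"
  let ?f = "\<lambda>A :: nat set. min (Min A) ?q"
  have Min: "Min A \<in> A" "finite A" if "A \<subseteq> {1..n}" "card A = k" for A
  proof -
    show fin: "finite A" using that(1) finite_subset by blast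
    show "Min A \<in> A" using fin that(2) assms(1) by (intro Min_in) auto
  qed
  have "proper_colouring (kneser_graph n k) ?q ?f"
    unfolding proper_colouring_def
  proof (intro conjI)
    have "?f A \<in> {1..?q}" if "A \<subseteq> {1..n}" "card A = k" for A
      using Min[OF that] that(1) by (auto simp: min_def)
    then show "?f ` pverts (kneser_graph n k) \<subseteq> {1..?q}"
      by (simp add: kneser_graph_def image_subset_iff)
    have "?f A \<noteq> ?f B"
      if A: "A \<subseteq> {1..n}" "card A = k" and B: "B \<subseteq> {1..n}" "card B = k" and AB: "A \<inter> B = {}" for A B
    proof
      assume eq: "?f A = ?f B"
      have "Min A \<noteq> Min B" using Min(1)[OF A] Min(1)[OF B] AB by (metis disjoint_iff)
      moreover have "a \<ge> q \<and> b \<ge> q" if "min a q = min b q" "a \<noteq> b" for a b q :: nat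
        using that by (auto simp: min_def split: if_splits)
      ultimately have "Min A \<ge> ?q" "Min B \<ge> ?q" using eq by presburger+
      then have "x \<ge> ?q" if "x \<in> A \<union> B" for x
        using Min_le[OF Min(2)[OF A], of x] Min_le[OF Min(2)[OF B], of x] that
        by (elim UnE) linarith+
      then have "A \<union> B \<subseteq> {?q..n}" using A(1) B(1) by (simp add: subset_iff)
      then have "card (A \<union> B) \<le> card {?q..n}" by (intro card_mono) auto
      moreover have "card (A \<union> B) = 2 * k"
        using card_Un_disjoint[of A B] Min(2)[OF A] Min(2)[OF B] A B AB by simp
      ultimately show False using assms by simp
    qed
    then show "\<forall>(u, v)\<in>parcs (kneser_graph n k). ?f u \<noteq> ?f v"
      by (auto simp: kneser_graph_def)
  qed
  then show ?thesis unfolding chromatic_number_def by (intro Least_le) blast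
qed

text \<open>\<open>large\<close> gives every \<open>M\<close>-set a colour held by many of its
  \<open>k\<close>-subsets, the bound on \<open>M\<close> allows Tucker's lemma, and
  \<open>nobi\<close> contradicts the directed biclique found in a colour class.\<close>

lemma not_proper_dicolouring_kneser_graph:
  assumes ori: "orientation D (kneser_graph n k)"
    and nobi: "\<And>S T. card S = r \<Longrightarrow> card T = r \<Longrightarrow> \<not> S \<times> T \<subseteq> parcs D"
    and r: "r \<ge> 1" and k: "k \<ge> 1" and M: "M \<ge> 1" "2 * M + d < n + 2"
    and large: "d * (2 * r) < M choose k"
  shows "\<not> proper_dicolouring D d f"
proof
  assume col: "proper_dicolouring D d f"
  interpret G: pair_graph "kneser_graph n k" by (rule pair_graph_kneser_graph[OF k])
  have VD: "pverts D = {A. A \<subseteq> {1..n} \<and> card A = k}"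
    using ori by (simp add: orientation_def kneser_graph_def)
  have AD: "parcs D \<union> (parcs D)\<inverse> = parcs (kneser_graph n k)" using ori by (simp add: orientation_def)
  then have ADs: "parcs D \<subseteq> parcs (kneser_graph n k)" by blast
  have wfD: "pair_wf_digraph D"
  proof
    fix e assume "e \<in> parcs D"
    then have "e \<in> parcs (kneser_graph n k)" using ADs by blast
    then show "fst e \<in> pverts D" "snd e \<in> pverts D" unfolding VD by (auto simp: kneser_graph_def)
  qed
  have finD: "finite (parcs D)" using ADs G.pair_finite_arcs finite_subset by blast
  define fam where "fam c S = {A. A \<subseteq> S \<and> card A = k \<and> f A = c}" for c S
  have fin_fam: "finite (fam c S)" if "S \<subseteq> {1..n}" for c S
    by (rule finite_subset[of _ "Pow {1..n}"]) (use that in \<open>auto simp: fam_def\<close>)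
  \<comment> \<open>Pigeonhole: otherwise the \<open>d\<close> colours would account for at most
    \<open>d * (2 * r)\<close> of the \<open>k\<close>-subsets of \<open>S\<close>.\<close>
  have "\<exists>c\<in>{1..d}. 2 * r \<le> card (fam c S)" if S: "S \<subseteq> {1..n}" "card S \<ge> M" for S
  proof (rule ccontr)
    assume "\<not> ?thesis"
    then have small: "card (fam c S) \<le> 2 * r" if "c \<in> {1..d}" for c using that by force
    have finS: "finite S" using S(1) finite_subset by blast
    have "M choose k \<le> card S choose k" using S(2) by (rule binomial_right_mono)
    also have "\<dots> = card {A. A \<subseteq> S \<and> card A = k}" using n_subsets[OF finS] by simp
    also have "{A. A \<subseteq> S \<and> card A = k} = (\<Union>c\<in>{1..d}. fam c S)"
    proof -
      have "f A \<in> {1..d}" if "A \<subseteq> S" "card A = k" for A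
      proof -
        have "A \<in> pverts D" using that S(1) by (auto simp: VD)
        then show ?thesis using col by (auto simp: proper_dicolouring_def)
      qed
      then show ?thesis by (auto simp: fam_def)
    qed
    also have "card \<dots> \<le> (\<Sum>c\<in>{1..d}. card (fam c S))" by (rule card_UN_le) simp
    also have "\<dots> \<le> (\<Sum>c\<in>{1..d}. 2 * r)" by (rule sum_mono) (rule small)
    also have "\<dots> = d * (2 * r)" by simp
    finally show False using large by simp
  qed
  then obtain c S T where c: "c \<in> {1..d}" and ST: "S \<subseteq> {1..n}" "T \<subseteq> {1..n}" "S \<inter> T = {}"
    and cards: "2 * r \<le> card (fam c S)" "2 * r \<le> card (fam c T)"
    using ex_disjoint_same_colour[of n M d "\<lambda>c S. 2 * r \<le> card (fam c S)"] M by blast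
  let ?C = "{v \<in> pverts D. f v = c}"
  have "acyclic_digraph (with_proj D \<restriction> ?C)" using col c by (auto simp: proper_dicolouring_def)
  then have ac: "acyclic (parcs D \<inter> ?C \<times> ?C)" by (rule acyclic_induced_arcs[OF wfD])
  \<comment> \<open>Members of the two families are disjoint because \<open>S\<close> and
    \<open>T\<close> are, so each such pair is an edge inside the colour class.\<close>
  have "(a, b) \<in> parcs D \<inter> ?C \<times> ?C \<or> (b, a) \<in> parcs D \<inter> ?C \<times> ?C"
    if ab: "a \<in> fam c S" "b \<in> fam c T" for a b
  proof -
    have "a \<in> ?C" "b \<in> ?C" using ab ST by (auto simp: fam_def VD)
    moreover have "(a, b) \<in> parcs (kneser_graph n k)"
      using ab ST by (auto simp: fam_def kneser_graph_def)
    then have "(a, b) \<in> parcs D \<or> (b, a) \<in> parcs D" using AD by blast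
    ultimately show ?thesis by blast
  qed
  then obtain S' T' where "card S' = r" "card T' = r" "S' \<times> T' \<subseteq> parcs D \<inter> ?C \<times> ?C"
    using acyclic_bipartite_contains_directed_biclique[OF _ ac fin_fam[OF ST(1)] fin_fam[OF ST(2)] cards r]
      finD by blast
  then show False using nobi by blast
qed

lemma dichromatic_number_le_graph_dichromatic_number:
  assumes "pair_graph G" "orientation D G"
  shows "dichromatic_number D \<le> graph_dichromatic_number G"
  unfolding graph_dichromatic_number_def
proof (rule Max_ge)
  have "{dichromatic_number D | D. orientation D G} = dichromatic_number ` {D. orientation D G}" by auto
  then show "finite {dichromatic_number D | D. orientation D G}"
    using pair_graph.finite_orientations[OF assms(1)] by simp
qed (use assms(2) in blast)

lemma ex_proper_dicolouring_dichromatic_number: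
  assumes "pair_graph G" "orientation D G"
  shows "\<exists>f. proper_dicolouring D (dichromatic_number D) f"
proof -
  have "\<exists>k f. proper_dicolouring D k f"
    using pair_graph.ex_proper_colouring[OF assms(1)]
      pair_graph.proper_colouring_imp_proper_dicolouring[OF assms] by blast
  then show ?thesis unfolding dichromatic_number_def by (rule LeastI_ex)
qed

section \<open>Numerical estimates\<close>

text \<open>\<open>4 * m + 3\<close> is the largest \<open>n\<close> with
  \<open>n div 4 = m\<close>. In the induction step the left side grows by a factor of at most
  \<open>(9 / 8) ^ 4 = 6561 / 4096 < 2\<close>.\<close>

lemma power4_less_power2: "30 \<le> m \<Longrightarrow> (4 * m + 3) ^ 4 < (2 :: nat) ^ m"
proof (induction m rule: dec_induct)
  case base
  show ?case by simp
next
  case (step m)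
  have "(8 * (4 * Suc m + 3)) ^ 4 \<le> (9 * (4 * m + 3)) ^ 4"
    by (rule power_mono) (use step in auto)
  then have "4096 * (4 * Suc m + 3) ^ 4 \<le> 6561 * (4 * m + 3) ^ 4"
    unfolding power_mult_distrib by simp
  then have "(4 * Suc m + 3) ^ 4 \<le> 2 * (4 * m + 3) ^ 4" by linarith
  then show ?case using step.IH unfolding power_Suc by linarith
qed

text \<open>Both \<open>k\<close> and \<open>m - k\<close> are at least 3, and one of them is at
  most \<open>m / 2\<close>, up to where the binomial coefficients increase.\<close>

lemma choose_three_le_choose:
  assumes "3 \<le> k" "k + 3 \<le> m"
  shows "m choose 3 \<le> m choose k"
proof (cases "2 * k \<le> m")
  case True
  then show ?thesis using assms by (intro binomial_mono) auto
next
  case False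
  then have "m choose 3 \<le> m choose (m - k)" using assms by (intro binomial_mono) auto
  then show ?thesis using binomial_symmetric[of k m] assms by simp
qed

lemma six_times_choose_three: "6 * (m choose 3) = m * ((m - 1) * (m - 2))" for m :: nat
proof -
  have "3 * (m choose 3) = m * ((m - 1) choose 2)" using times_binomial_minus1_eq[of 3 m] by simp
  moreover have "2 * ((m - 1) choose 2) = (m - 1) * (m - 2)"
    using times_binomial_minus1_eq[of 2 "m - 1"] by (simp add: numeral_2_eq_2)
  ultimately show ?thesis by (metis mult.assoc mult.left_commute mult_2 numeral_Bit0 mult_numeral_1)
qed

text \<open>\<open>r\<close> must be large enough for a good orientation, yet small enough for the
  pigeonhole step. For \<open>k = 2\<close> both sides of the last inequality are quadratic in
  \<open>n\<close>, so constants matter; for larger \<open>k\<close> the right side is at least of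
  cubic order.\<close>

lemma ex_biclique_size:
  fixes n k :: nat
  assumes n: "n \<ge> 128" and k: "2 \<le> k" "2 * k \<le> n"
  obtains r where "r \<ge> 1" "(n choose k) ^ 2 < 2 ^ r"
    "\<And>d. 16 * (d + 1) \<le> n - 2 * k + 2 \<Longrightarrow> d * (2 * r) < ((n - d) div 2) choose k"
proof (cases "k = 2")
  case True
  let ?r = "n div 4"
  show thesis
  proof
    show "?r \<ge> 1" using n by simp
    have "n choose k \<le> n ^ 2" using True n binomial_le_pow[of 2 n] by simp
    then have "(n choose k) ^ 2 \<le> (n ^ 2) ^ 2" by (intro power_mono) auto
    also have "\<dots> = n ^ 4" by (simp flip: power_mult)
    also have "\<dots> \<le> (4 * ?r + 3) ^ 4" by (rule power_mono) auto
    also have "\<dots> < 2 ^ ?r" using n by (intro power4_less_power2) auto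
    finally show "(n choose k) ^ 2 < 2 ^ ?r" .
    fix d assume d: "16 * (d + 1) \<le> n - 2 * k + 2"
    define M where "M = (n - d) div 2"
    \<comment> \<open>As \<open>d < n / 16\<close>, \<open>M\<close> is about
      \<open>15 * n / 32\<close>. Subtracting 1 is paid for by giving up
      \<open>n / 32\<close>.\<close>
    have M: "15 * n \<le> 32 * M" "14 * n \<le> 32 * (M - 1)" using d n True unfolding M_def by auto
    have "(16 * d) * (4 * ?r) \<le> n * n" using d True by (intro mult_le_mono) auto
    moreover have "(15 * n) * (14 * n) \<le> (32 * M) * (32 * (M - 1))" by (rule mult_le_mono[OF M])
    moreover have "2 * (M choose 2) = M * (M - 1)"
      using times_binomial_minus1_eq[of 2 M] by (simp add: numeral_2_eq_2)
    moreover have "n * n > 0" using n by simp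
    moreover have "(16 * d) * (4 * ?r) = 32 * (d * (2 * ?r))" by simp
    moreover have "(15 * n) * (14 * n) = 210 * (n * n)" by simp
    moreover have "(32 * M) * (32 * (M - 1)) = 1024 * (M * (M - 1))" by simp
    ultimately have "d * (2 * ?r) < M choose 2" by linarith
    then show "d * (2 * ?r) < ((n - d) div 2) choose k" using True by (simp add: M_def)
  qed
next
  case False
  let ?r = "2 * n + 1"
  show thesis
  proof
    show "?r \<ge> 1" by simp
    have "n choose k \<le> 2 ^ n" by (rule binomial_le_pow2)
    then have "(n choose k) ^ 2 \<le> (2 ^ n) ^ 2" by (intro power_mono) auto
    also have "\<dots> = 2 ^ (2 * n)" by (simp add: power_mult[symmetric] mult.commute)
    also have "\<dots> < 2 ^ ?r" by simp
    finally show "(n choose k) ^ 2 < 2 ^ ?r" .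
    fix d assume d: "16 * (d + 1) \<le> n - 2 * k + 2"
    define M where "M = (n - d) div 2"
    have M: "15 * n \<le> 32 * M" "14 * n \<le> 32 * (M - 1)" "13 * n \<le> 32 * (M - 2)"
      using d n k unfolding M_def by auto
    \<comment> \<open>The hypothesis on \<open>d\<close> gives
      \<open>k \<le> n / 2 - 7 - 8 * d\<close>, which is well below \<open>M\<close>.\<close>
    have "k + 3 \<le> M" using d n k unfolding M_def by auto
    then have "M choose 3 \<le> M choose k" using False k by (intro choose_three_le_choose) auto
    moreover have "d * (2 * ?r) < M choose 3"
    proof -
      have "(16 * d) * (2 * ?r) \<le> n * (5 * n)" using d n by (intro mult_le_mono[of _ n]) auto
      moreover have "(15 * n) * ((14 * n) * (13 * n)) \<le> (32 * M) * ((32 * (M - 1)) * (32 * (M - 2)))"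
        by (rule mult_le_mono[OF M(1) mult_le_mono[OF M(2,3)]])
      \<comment> \<open>Here \<open>n \<ge> 128\<close> makes the cubic lower bound comparable with
        the quadratic upper bound; the products then serve as atoms for
        \<open>linarith\<close>.\<close>
      moreover have "(n * n) * 128 \<le> (n * n) * n" using n by (rule mult_le_mono2)
      moreover have "n * n > 0" using n by simp
      moreover have "(16 * d) * (2 * ?r) = 16 * (d * (2 * ?r))" "n * (5 * n) = 5 * (n * n)"
        by simp_all
      moreover have "(15 * n) * ((14 * n) * (13 * n)) = 2730 * ((n * n) * n)" by simp
      moreover have "(32 * M) * ((32 * (M - 1)) * (32 * (M - 2))) = 32768 * (M * ((M - 1) * (M - 2)))"
        by simp
      ultimately show ?thesis using six_times_choose_three[of M] by linarith
    qed
    ultimately show "d * (2 * ?r) < ((n - d) div 2) choose k" by (simp add: M_def)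
  qed
qed

section \<open>The lower bound for Kneser graphs with at least 128 ground elements\<close>

theorem theorem6:
  shows "\<exists>n\<^sub>0::nat. n\<^sub>0 > 0 \<and>
    (\<forall>n k :: nat. n \<ge> n\<^sub>0 \<and> 2 \<le> k \<and> real k \<le> real n / 2 \<longrightarrow>
      int (graph_dichromatic_number (kneser_graph n k))
        \<ge> \<lfloor>1 / 16 * real (chromatic_number (kneser_graph n k))\<rfloor>)"
proof (intro exI[of _ 128] conjI allI impI)
  fix n k :: nat
  assume "128 \<le> n \<and> 2 \<le> k \<and> real k \<le> real n / 2"
  then have n: "n \<ge> 128" and k: "2 \<le> k" "2 * k \<le> n" by linarith+
  let ?G = "kneser_graph n k"
  have G: "pair_graph ?G" using k by (intro pair_graph_kneser_graph) simp
  obtain r where r: "r \<ge> 1" "(n choose k) ^ 2 < 2 ^ r"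
    "\<And>d. 16 * (d + 1) \<le> n - 2 * k + 2 \<Longrightarrow> d * (2 * r) < ((n - d) div 2) choose k"
    using ex_biclique_size[OF n k] by blast
  have "card (pverts ?G) = n choose k"
    using n_subsets[of "{1..n}" k] by (simp add: kneser_graph_def)
  then obtain D where D: "orientation D ?G"
    "\<And>S T. card S = r \<Longrightarrow> card T = r \<Longrightarrow> \<not> S \<times> T \<subseteq> parcs D"
    using pair_graph.ex_orientation_without_directed_biclique[OF G, of r] r by auto
  define d where "d = dichromatic_number D"
  obtain f where f: "proper_dicolouring D d f"
    using ex_proper_dicolouring_dichromatic_number[OF G D(1)] by (auto simp: d_def)
  \<comment> \<open>A smaller \<open>d\<close> would fall under \<open>r(3)\<close>, and then
    \<open>D\<close> has no dicolouring with \<open>d\<close> colours. The sets used have size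
    \<open>M = (n - d) div 2\<close>, so that \<open>2 * M + d \<le> n\<close>.\<close>
  have d: "n - 2 * k + 2 < 16 * (d + 1)"
  proof (rule ccontr)
    assume "\<not> ?thesis"
    then have le: "16 * (d + 1) \<le> n - 2 * k + 2" by simp
    obtain j where "n = 2 * k + j" using k(2) by (rule le_Suc_ex[THEN exE])
    then have "d + 2 \<le> n" using le k(1) by simp
    then have "(n - d) div 2 \<ge> 1" "2 * ((n - d) div 2) + d < n + 2" by linarith+
    then have "\<not> proper_dicolouring D d f"
      using k by (intro not_proper_dicolouring_kneser_graph[OF D r(1) _ _ _ r(3)[OF le]]) auto
    then show False using f by blast
  qed
  have "chromatic_number ?G \<le> n - 2 * k + 2" using k by (intro chromatic_number_kneser_graph_le) auto
  then have "chromatic_number ?G < 16 * (d + 1)" using d by simp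
  then have "real (chromatic_number ?G) < real (16 * (d + 1))" by (rule of_nat_less_iff[THEN iffD2])
  then have "\<lfloor>1 / 16 * real (chromatic_number ?G)\<rfloor> \<le> int d" by (simp add: floor_le_iff)
  also have "d \<le> graph_dichromatic_number ?G"
    unfolding d_def by (rule dichromatic_number_le_graph_dichromatic_number[OF G D(1)])
  finally show "int (graph_dichromatic_number ?G) \<ge> \<lfloor>1 / 16 * real (chromatic_number ?G)\<rfloor>"
    by simp
qed simp

end
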